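(* The solutions of the equation $$\left\langle\begin{pmatrix}0\\1\end{pmatrix},N_Y\right\rangle=k_Y^{1/3}$$ for curves $Y$ in $\mathbb{R}^2$ are the parabolas $y=\frac12x^2+C_1x+C_2$ and the lines $x=C$, where $C_1$, $C_2$ and $C$ are arbitrary constants.
   Context: Points of $\mathbb{R}^2$ are written as $(x,y)$. Curves are smooth immersed curves. For a curve $Y=Y(u)$, put $T=Y_u/\|Y_u\|$, $N_Y=JT$ with $J=\begin{pmatrix}0&-1\\1&0\end{pmatrix}$ (unit normal), and $k_Y=\det(Y_u,Y_{uu})/\|Y_u\|^3$ (curvature with respect to $N_Y$). $\langle\cdot,\cdot\rangle$ is the Euclidean inner product and $k^{1/3}$ is the real (odd) cube root. Solutions are regarded as geometric curves (up to reparametrization), connected and maximally extended. *)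

theory Defs
  imports "HOL-Analysis.Analysis"
begin

definition vderiv :: "nat \<Rightarrow> (real \<Rightarrow> 'a::real_normed_vector) \<Rightarrow> real \<Rightarrow> 'a" where
  "vderiv n f = ((\<lambda>g u. vector_derivative g (at u)) ^^ n) f"

text \<open>C-infinity smoothness; meaningful for open \<open>I\<close>, where all derivatives at points
  of \<open>I\<close> depend only on the values of \<open>f\<close> on \<open>I\<close>.\<close>

definition smooth_on :: "real set \<Rightarrow> (real \<Rightarrow> 'a::real_normed_vector) \<Rightarrow> bool" where
  "smooth_on I f \<longleftrightarrow> (\<forall>n. vderiv n f differentiable_on I)"

text \<open>A connected parametrized curve is a pair of a nonempty open interval \<open>I\<close> (bounded or not)
  and a map \<open>Y\<close>, whose values outside \<open>I\<close> are irrelevant.\<close>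

definition immersed_curve :: "real set \<Rightarrow> (real \<Rightarrow> real^2) \<Rightarrow> bool" where
  "immersed_curve I Y \<longleftrightarrow>
     open I \<and> connected I \<and> I \<noteq> {} \<and> smooth_on I Y \<and> (\<forall>u\<in>I. vderiv 1 Y u \<noteq> 0)"

definition unit_tangent :: "(real \<Rightarrow> real^2) \<Rightarrow> real \<Rightarrow> real^2" where
  "unit_tangent Y u = vderiv 1 Y u /\<^sub>R norm (vderiv 1 Y u)"

definition rot_J :: "real^2^2" where
  "rot_J = vector [vector [0, -1], vector [1, 0]]"

definition unit_normal :: "(real \<Rightarrow> real^2) \<Rightarrow> real \<Rightarrow> real^2" where
  "unit_normal Y u = rot_J *v unit_tangent Y u"

text \<open>\<open>vector [v, w]\<close> is the matrix with rows \<open>v\<close> and \<open>w\<close>, hence the transposition.\<close>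

definition curvature :: "(real \<Rightarrow> real^2) \<Rightarrow> real \<Rightarrow> real" where
  "curvature Y u =
     det (transpose (vector [vderiv 1 Y u, vderiv 2 Y u] :: real^2^2)) / norm (vderiv 1 Y u) ^ 3"

text \<open>\<open>root 3\<close> is the odd real cube root, defined on all of the reals.\<close>

definition solution :: "real set \<Rightarrow> (real \<Rightarrow> real^2) \<Rightarrow> bool" where
  "solution I Y \<longleftrightarrow> immersed_curve I Y \<and>
     (\<forall>u\<in>I. (vector [0, 1] :: real^2) \<bullet> unit_normal Y u = root 3 (curvature Y u))"

text \<open>Regular changes of parameter, of either orientation: the equation is invariant under
  reversal, since both the normal and the curvature change sign.\<close>

definition param_change :: "real set \<Rightarrow> real set \<Rightarrow> (real \<Rightarrow> real) \<Rightarrow> bool" where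
  "param_change I J \<phi> \<longleftrightarrow>
     bij_betw \<phi> I J \<and> smooth_on I \<phi> \<and> (\<forall>u\<in>I. vderiv 1 \<phi> u \<noteq> 0)"

definition same_curve ::
  "real set \<Rightarrow> (real \<Rightarrow> real^2) \<Rightarrow> real set \<Rightarrow> (real \<Rightarrow> real^2) \<Rightarrow> bool" where
  "same_curve I Y J Z \<longleftrightarrow> (\<exists>\<phi>. param_change I J \<phi> \<and> (\<forall>u\<in>I. Y u = Z (\<phi> u)))"

text \<open>Maximally extended: whenever \<open>Y\<close> is, up to a change of parameter, the restriction to
  \<open>\<phi> ` I\<close> of a solution \<open>Z\<close> on \<open>J\<close>, then \<open>\<phi> ` I\<close> is all of \<open>J\<close>.\<close>

definition maximal_solution :: "real set \<Rightarrow> (real \<Rightarrow> real^2) \<Rightarrow> bool" where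
  "maximal_solution I Y \<longleftrightarrow> solution I Y \<and>
     (\<forall>J Z \<phi>. solution J Z \<and> \<phi> ` I \<subseteq> J \<and> param_change I (\<phi> ` I) \<phi> \<and>
        (\<forall>u\<in>I. Y u = Z (\<phi> u)) \<longrightarrow> \<phi> ` I = J)"

end

theory Submission
  imports Defs
begin

text \<open>Write \<open>Y = (x, y)\<close>. Multiplying by the speed and cubing turns the equation into
  \<open>x'\<^sup>3 = x' y'' - y' x''\<close>, which says exactly that \<open>p = x'\<close> and \<open>q = y' - x x'\<close> have vanishing
  Wronskian. For an immersed curve these two functions have no common zero, so the vector they
  form has constant direction: \<open>p\<^sub>0 q = q\<^sub>0 p\<close> on the whole interval, for constants
  \<open>(p\<^sub>0, q\<^sub>0) \<noteq> 0\<close> (lemma \<open>proportional_if_wronskian_zero\<close>). One integration gives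
  \<open>p\<^sub>0 (y - x\<^sup>2 / 2) - q\<^sub>0 x = c\<close>, a parabola of the family if \<open>p\<^sub>0 \<noteq> 0\<close> and a vertical line if
  \<open>p\<^sub>0 = 0\<close>. Conversely, differentiating \<open>y = x\<^sup>2 / 2 + C\<^sub>1 x + C\<^sub>2\<close> or \<open>x = C\<close> twice along an
  immersed curve gives the equation back.

  Each of the model curves \<open>P\<close> is parametrized by one of the two coordinates. An immersed curve
  lying on \<open>P\<close> is therefore parametrized by the same coordinate, with nonzero derivative (lemma
  \<open>coordinate_param_change\<close>). If the curve is maximal, comparison with \<open>P\<close> itself shows that the
  coordinate takes all real values. Conversely, suppose that it does, and consider a solution
  extending the curve. It lies on a model curve that contains all of \<open>P\<close>, hence on one
  parametrized by the same coordinate. This coordinate is injective along the extension and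
  already takes all real values on the given part, so no parameter is left over.\<close>

section \<open>Derivatives of smooth curves\<close>

lemma vderiv_Suc: "vderiv (Suc n) f u = vector_derivative (vderiv n f) (at u)"
  by (simp add: vderiv_def)

lemma vderiv_0 [simp]: "vderiv 0 f = f"
  by (simp add: vderiv_def)

lemma has_vector_derivative_vderiv:
  assumes "smooth_on I f" "open I" "u \<in> I"
  shows "(vderiv n f has_vector_derivative vderiv (Suc n) f u) (at u)"
proof -
  have "vderiv n f differentiable at u"
    using assms by (simp add: smooth_on_def differentiable_on_eq_differentiable_at)
  then show ?thesis
    by (simp add: vderiv_Suc vector_derivative_works)
qed

lemma has_field_derivative_vderiv_component:
  fixes f :: "real \<Rightarrow> real^'n"
  assumes "smooth_on I f" "open I" "u \<in> I"
  shows "((\<lambda>u. vderiv n f u $ i) has_field_derivative vderiv (Suc n) f u $ i) (at u)"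
  using has_vector_derivative_vderiv[OF assms, of n]
  unfolding has_real_derivative_iff_has_vector_derivative
  by (rule bounded_linear.has_vector_derivative[OF bounded_linear_vec_nth])

lemma vderiv_component:
  fixes f :: "real \<Rightarrow> real^'n"
  assumes "smooth_on I f" "open I" "u \<in> I"
  shows "vderiv n (\<lambda>u. f u $ i) u = vderiv n f u $ i"
  using assms(3)
proof (induction n arbitrary: u)
  case (Suc n)
  have "((\<lambda>u. vderiv n f u $ i) has_vector_derivative vderiv (Suc n) f u $ i) (at u)"
    using has_field_derivative_vderiv_component[OF assms(1,2) Suc.prems]
    by (simp add: has_real_derivative_iff_has_vector_derivative)
  then have "(vderiv n (\<lambda>u. f u $ i) has_vector_derivative vderiv (Suc n) f u $ i) (at u)"
    by (rule has_vector_derivative_transform_within_open[OF _ assms(2) Suc.prems])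
       (simp add: Suc.IH)
  then show ?case
    by (simp add: vderiv_Suc vector_derivative_at)
qed simp

lemma smooth_on_component:
  fixes f :: "real \<Rightarrow> real^'n"
  assumes "smooth_on I f" "open I"
  shows "smooth_on I (\<lambda>u. f u $ i)"
  unfolding smooth_on_def
proof (intro allI differentiable_at_imp_differentiable_on)
  fix n u assume u: "u \<in> I"
  have "((\<lambda>u. vderiv n f u $ i) has_vector_derivative vderiv (Suc n) f u $ i) (at u)"
    using has_field_derivative_vderiv_component[OF assms u]
    by (simp add: has_real_derivative_iff_has_vector_derivative)
  then have "(vderiv n (\<lambda>u. f u $ i) has_vector_derivative vderiv (Suc n) f u $ i) (at u)"
    by (rule has_vector_derivative_transform_within_open[OF _ assms(2) u])
       (simp add: vderiv_component[OF assms])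
  then show "vderiv n (\<lambda>u. f u $ i) differentiable at u"
    by (rule differentiableI_vector)
qed

lemma vderiv_antiderivative:
  assumes "\<And>u. (f has_vector_derivative f' u) (at u)"
  shows "vderiv (Suc n) f = vderiv n f'"
proof -
  have "(\<lambda>u. vector_derivative f (at u)) = f'"
    using assms by (auto simp: vector_derivative_at)
  then show ?thesis
    by (simp add: vderiv_def funpow_Suc_right del: funpow.simps(2))
qed

lemma smooth_on_antiderivative:
  assumes f: "\<And>u. (f has_vector_derivative f' u) (at u)" and f': "smooth_on UNIV f'"
  shows "smooth_on UNIV f"
  unfolding smooth_on_def
proof
  fix n show "vderiv n f differentiable_on UNIV"
  proof (cases n)
    case 0
    then show ?thesis
      using f by (auto intro!: differentiable_at_imp_differentiable_on differentiableI_vector)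
  next
    case (Suc m)
    then show ?thesis
      using f' vderiv_antiderivative[OF f] by (simp add: smooth_on_def)
  qed
qed

lemma smooth_on_const: "smooth_on UNIV (\<lambda>u. c)"
proof -
  have "vderiv n (\<lambda>u. c) = (\<lambda>u. if n = 0 then c else 0)" for n
  proof (induction n)
    case (Suc n)
    show ?case
      by (rule ext) (simp add: vderiv_Suc Suc.IH)
  qed simp
  then show ?thesis
    by (simp add: smooth_on_def)
qed

lemma deriv_eq_on_open:
  fixes f g :: "real \<Rightarrow> real"
  assumes "(f has_field_derivative f') (at u)" "(g has_field_derivative g') (at u)"
    and "open I" "u \<in> I" "\<And>v. v \<in> I \<Longrightarrow> f v = g v"
  shows "f' = g'"
  using DERIV_unique[OF has_field_derivative_transform_within_open[OF assms(1,3,4,5)] assms(2)] .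

lemma constant_if_deriv_zero:
  fixes f :: "real \<Rightarrow> real"
  assumes "open I" "connected I" "\<And>u. u \<in> I \<Longrightarrow> (f has_field_derivative 0) (at u)"
  obtains c where "\<And>u. u \<in> I \<Longrightarrow> f u = c"
proof -
  have "convex I"
    using assms(2) by (simp add: is_interval_connected_1 flip: is_interval_convex_1)
  then have "\<exists>c. \<forall>u\<in>I. f u = c"
    using assms(3) by (intro has_field_derivative_zero_constant) (auto intro: DERIV_subset)
  then show ?thesis
    using that by blast
qed

lemma inj_on_if_deriv_nonzero:
  fixes f f' :: "real \<Rightarrow> real"
  assumes "connected I" "\<And>u. u \<in> I \<Longrightarrow> (f has_field_derivative f' u) (at u)"
    and "\<And>u. u \<in> I \<Longrightarrow> f' u \<noteq> 0"
  shows "inj_on f I"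
proof (rule linorder_inj_onI')
  fix a b assume ab: "a \<in> I" "b \<in> I" "a < b"
  then have I: "{a..b} \<subseteq> I"
    using assms(1) connected_contains_Icc by blast
  show "f a \<noteq> f b"
  proof
    assume eq: "f a = f b"
    have "continuous_on {a..b} f"
      using I assms(2) by (intro continuous_at_imp_continuous_on) (blast intro: DERIV_isCont)
    moreover have "(f has_derivative (*) (f' z)) (at z)" if "a < z" "z < b" for z
    proof -
      have "z \<in> I"
        using I that by auto
      from assms(2)[OF this] show ?thesis
        by (simp only: has_field_derivative_def)
    qed
    ultimately have "\<exists>z. a < z \<and> z < b \<and> (*) (f' z) = (\<lambda>v. 0)"
      using Rolle_deriv[OF ab(3) eq, of "\<lambda>z. (*) (f' z)"] by blast
    then obtain z where z: "a < z" "z < b" "(*) (f' z) = (\<lambda>v. 0)"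
      by blast
    have "z \<in> I"
      using z(1,2) I by auto
    moreover have "f' z * 1 = 0"
      using z(3) by (rule fun_cong)
    ultimately show False
      using assms(3)[of z] by simp
  qed
qed

section \<open>The equation in coordinates\<close>

text \<open>The cube root turns the third power of the speed in the curvature into the first power,
  which cancels against the normalization of the tangent.\<close>

lemma solution_iff_coordinates:
  "solution I Y \<longleftrightarrow> immersed_curve I Y \<and>
     (\<forall>u\<in>I. (vderiv 1 Y u $ 1) ^ 3 =
        vderiv 1 Y u $ 1 * vderiv 2 Y u $ 2 - vderiv 1 Y u $ 2 * vderiv 2 Y u $ 1)"
proof -
  have "(vector [0, 1] :: real^2) \<bullet> unit_normal Y u = root 3 (curvature Y u) \<longleftrightarrow>
      (vderiv 1 Y u $ 1) ^ 3 =
        vderiv 1 Y u $ 1 * vderiv 2 Y u $ 2 - vderiv 1 Y u $ 2 * vderiv 2 Y u $ 1"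
    if "vderiv 1 Y u \<noteq> 0" for u
  proof -
    define d where
      "d = vderiv 1 Y u $ 1 * vderiv 2 Y u $ 2 - vderiv 1 Y u $ 2 * vderiv 2 Y u $ 1"
    define s where "s = norm (vderiv 1 Y u)"
    have s: "s > 0"
      using that by (simp add: s_def)
    have "(vector [0, 1] :: real^2) \<bullet> unit_normal Y u = vderiv 1 Y u $ 1 / s"
      by (simp add: unit_normal_def unit_tangent_def rot_J_def matrix_vector_mult_def
          inner_vec_def sum_2 s_def divide_inverse)
    moreover have "curvature Y u = d / s ^ 3"
      unfolding curvature_def det_transpose by (simp add: det_2 d_def s_def)
    then have "root 3 (curvature Y u) = root 3 d / s"
      using s by (simp add: real_root_divide real_root_power_cancel)
    moreover have "vderiv 1 Y u $ 1 = root 3 d \<longleftrightarrow> (vderiv 1 Y u $ 1) ^ 3 = d"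
      by (metis odd_numeral odd_real_root_power_cancel odd_real_root_pow)
    ultimately show ?thesis
      using s by (simp add: d_def)
  qed
  then show ?thesis
    by (auto simp: solution_def immersed_curve_def)
qed

section \<open>Solutions lie on parabolas and vertical lines\<close>

text \<open>The vector \<open>(p, q)\<close> never vanishes and its derivative is parallel to it, so its direction is
  constant. The proof differentiates the squared sine, up to a constant factor, of the angle
  between \<open>(p, q)\<close> and its value at \<open>a\<close>.\<close>

lemma proportional_if_wronskian_zero:
  fixes p q p' q' :: "real \<Rightarrow> real"
  assumes I: "open I" "connected I" "a \<in> I" "u \<in> I"
    and p: "\<And>u. u \<in> I \<Longrightarrow> (p has_field_derivative p' u) (at u)"
    and q: "\<And>u. u \<in> I \<Longrightarrow> (q has_field_derivative q' u) (at u)"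
    and wronskian: "\<And>u. u \<in> I \<Longrightarrow> p u * q' u = q u * p' u"
    and nz: "\<And>u. u \<in> I \<Longrightarrow> p u \<noteq> 0 \<or> q u \<noteq> 0"
  shows "p a * q u = q a * p u"
proof -
  define n where "n u = (p u)\<^sup>2 + (q u)\<^sup>2" for u
  define g where "g u = p a * q u - q a * p u" for u
  have n: "n u \<noteq> 0" if "u \<in> I" for u
    using nz[OF that] by (simp add: n_def sum_power2_eq_zero_iff)
  have "((\<lambda>u. (g u)\<^sup>2 / n u) has_field_derivative 0) (at u)" if u: "u \<in> I" for u
  proof -
    define g' where "g' = p a * q' u - q a * p' u"
    define n' where "n' = 2 * (p u * p' u + q u * q' u)"
    have g: "(g has_field_derivative g') (at u)"
      unfolding g_def g'_def using p[OF u] q[OF u] by (auto intro!: derivative_eq_intros)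
    have dn: "(n has_field_derivative n') (at u)"
      unfolding n_def n'_def using p[OF u] q[OF u]
      by (auto intro!: derivative_eq_intros simp: algebra_simps)
    have "2 * g' * n u - g u * n' = 2 * (p a * p u + q a * q u) * (p u * q' u - q u * p' u)"
      by (simp add: g_def g'_def n_def n'_def power2_eq_square algebra_simps)
    then have eq: "2 * g' * n u = g u * n'"
      using wronskian[OF u] by simp
    have "2 * g u * g' * n u - (g u)\<^sup>2 * n' = g u * (2 * g' * n u - g u * n')"
      by (simp add: power2_eq_square algebra_simps)
    also have "\<dots> = 0"
      using eq by simp
    finally have "(2 * g u * g' * n u - (g u)\<^sup>2 * n') / (n u * n u) = 0"
      by simp
    moreover have "((\<lambda>u. (g u)\<^sup>2) has_field_derivative 2 * g u * g') (at u)"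
      using g by (auto intro!: derivative_eq_intros)
    ultimately show ?thesis
      using DERIV_divide[OF _ dn n[OF u], of "\<lambda>u. (g u)\<^sup>2" "2 * g u * g'"]
      by (metis (no_types, lifting))
  qed
  then obtain c where c: "\<And>u. u \<in> I \<Longrightarrow> (g u)\<^sup>2 / n u = c"
    using constant_if_deriv_zero[OF I(1,2)] by blast
  have "c = 0"
    using c[OF I(3)] by (simp add: g_def)
  then have "g u = 0"
    using c[OF I(4)] n[OF I(4)] by simp
  then show ?thesis
    by (simp add: g_def)
qed

abbreviation (input) parabola :: "real \<Rightarrow> real \<Rightarrow> real \<Rightarrow> real^2" where
  "parabola C1 C2 \<equiv> \<lambda>x. vector [x, 1/2 * x^2 + C1 * x + C2]"

abbreviation (input) vertical_line :: "real \<Rightarrow> real \<Rightarrow> real^2" where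
  "vertical_line C \<equiv> \<lambda>y. vector [C, y]"

lemma solution_on_parabola_or_line:
  assumes "solution I Y"
  shows "(\<exists>C1 C2. \<forall>u\<in>I. Y u = parabola C1 C2 (Y u $ 1)) \<or>
    (\<exists>C. \<forall>u\<in>I. Y u = vertical_line C (Y u $ 2))"
proof -
  have I: "open I" "connected I" and smooth: "smooth_on I Y"
    and imm: "\<And>u. u \<in> I \<Longrightarrow> vderiv 1 Y u \<noteq> 0"
    using assms by (auto simp: solution_def immersed_curve_def)
  obtain a where a: "a \<in> I"
    using assms by (auto simp: solution_def immersed_curve_def)
  have Y0: "((\<lambda>u. Y u $ i) has_field_derivative vderiv 1 Y u $ i) (at u)" if "u \<in> I" for u i
    using has_field_derivative_vderiv_component[OF smooth I(1) that, of 0 i] by simp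
  have Y1: "((\<lambda>u. vderiv 1 Y u $ i) has_field_derivative vderiv 2 Y u $ i) (at u)"
    if "u \<in> I" for u i
    using has_field_derivative_vderiv_component[OF smooth I(1) that, of 1 i]
    by (simp add: numeral_2_eq_2)
  define p where "p u = vderiv 1 Y u $ 1" for u
  define q where "q u = vderiv 1 Y u $ 2 - Y u $ 1 * vderiv 1 Y u $ 1" for u
  define q' where "q' u = vderiv 2 Y u $ 2 - (p u)\<^sup>2 - Y u $ 1 * vderiv 2 Y u $ 1" for u
  have q': "(q has_field_derivative q' u) (at u)" if "u \<in> I" for u
    unfolding q_def q'_def p_def using Y0[OF that] Y1[OF that]
    by (auto intro!: derivative_eq_intros simp: power2_eq_square algebra_simps)
  have nz: "p u \<noteq> 0 \<or> q u \<noteq> 0" if "u \<in> I" for u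
    using imm[OF that] by (auto simp: p_def q_def vec_eq_iff forall_2)
  \<comment> \<open>The terms with the factor \<open>x\<close> cancel, leaving the difference of the two sides of the
    equation.\<close>
  have wronskian: "p u * q' u = q u * vderiv 2 Y u $ 1" if "u \<in> I" for u
  proof -
    have "p u * q' u - q u * vderiv 2 Y u $ 1 =
        vderiv 1 Y u $ 1 * vderiv 2 Y u $ 2 - vderiv 1 Y u $ 2 * vderiv 2 Y u $ 1 - p u ^ 3"
      by (simp add: p_def q_def q'_def power2_eq_square power3_eq_cube algebra_simps)
    also have "\<dots> = 0"
      using assms that by (simp add: solution_iff_coordinates p_def)
    finally show ?thesis
      by simp
  qed
  have parallel: "p a * q u = q a * p u" if "u \<in> I" for u
    using proportional_if_wronskian_zero[OF I a that, of p "\<lambda>u. vderiv 2 Y u $ 1" q q']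
      Y1[of _ 1, folded p_def] q' nz wronskian by blast
  have "((\<lambda>u. p a * (Y u $ 2 - (Y u $ 1)\<^sup>2 / 2) - q a * Y u $ 1) has_field_derivative 0) (at u)"
    if u: "u \<in> I" for u
  proof -
    have "p a * (vderiv 1 Y u $ 2 - Y u $ 1 * vderiv 1 Y u $ 1) - q a * vderiv 1 Y u $ 1 = 0"
      using parallel[OF u] by (simp add: q_def p_def)
    then show ?thesis
      using Y0[OF u] by (auto intro!: derivative_eq_intros simp: algebra_simps)
  qed
  then obtain c where
    c: "\<And>u. u \<in> I \<Longrightarrow> p a * (Y u $ 2 - (Y u $ 1)\<^sup>2 / 2) - q a * Y u $ 1 = c"
    using constant_if_deriv_zero[OF I] by blast
  show ?thesis
  proof (cases "p a = 0")
    case True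
    then have "Y u $ 1 = - c / q a" if "u \<in> I" for u
      using c[OF that] nz[OF a] by (auto simp: field_simps)
    then have "\<forall>u\<in>I. Y u = vertical_line (- c / q a) (Y u $ 2)"
      by (simp add: vec_eq_iff forall_2)
    then show ?thesis
      by blast
  next
    case False
    then have "Y u $ 2 = 1/2 * (Y u $ 1)\<^sup>2 + q a / p a * Y u $ 1 + c / p a" if "u \<in> I" for u
      using c[OF that] by (simp add: field_simps)
    then have "\<forall>u\<in>I. Y u = parabola (q a / p a) (c / p a) (Y u $ 1)"
      by (simp add: vec_eq_iff forall_2)
    then show ?thesis
      by blast
  qed
qed

lemma solution_if_on_parabola:
  assumes "immersed_curve I Y" and on: "\<And>u. u \<in> I \<Longrightarrow> Y u = parabola C1 C2 (Y u $ 1)"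
  shows "solution I Y"
proof -
  have I: "open I" and smooth: "smooth_on I Y"
    using assms(1) by (auto simp: immersed_curve_def)
  have Y0: "((\<lambda>u. Y u $ i) has_field_derivative vderiv 1 Y u $ i) (at u)" if "u \<in> I" for u i
    using has_field_derivative_vderiv_component[OF smooth I that, of 0 i] by simp
  have Y1: "((\<lambda>u. vderiv 1 Y u $ i) has_field_derivative vderiv 2 Y u $ i) (at u)"
    if "u \<in> I" for u i
    using has_field_derivative_vderiv_component[OF smooth I that, of 1 i]
    by (simp add: numeral_2_eq_2)
  have y: "Y u $ 2 = 1/2 * (Y u $ 1)\<^sup>2 + C1 * Y u $ 1 + C2" if "u \<in> I" for u
    using arg_cong[OF on[OF that], of "\<lambda>v. v $ 2"] by simp
  have y1: "vderiv 1 Y u $ 2 = (Y u $ 1 + C1) * vderiv 1 Y u $ 1" if "u \<in> I" for u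
    by (rule deriv_eq_on_open[OF Y0[OF that] _ I that y])
       (use Y0[OF that] in \<open>auto intro!: derivative_eq_intros simp: algebra_simps\<close>)
  have y2: "vderiv 2 Y u $ 2 = (vderiv 1 Y u $ 1)\<^sup>2 + (Y u $ 1 + C1) * vderiv 2 Y u $ 1"
    if "u \<in> I" for u
    by (rule deriv_eq_on_open[OF Y1[OF that] _ I that y1])
       (use Y0[OF that] Y1[OF that] in
         \<open>auto intro!: derivative_eq_intros simp: algebra_simps power2_eq_square\<close>)
  show ?thesis
    unfolding solution_iff_coordinates using assms(1)
    by (simp add: y1 y2 power2_eq_square power3_eq_cube algebra_simps del: One_nat_def)
qed

lemma solution_if_on_vertical_line:
  assumes "immersed_curve I Y" and on: "\<And>u. u \<in> I \<Longrightarrow> Y u = vertical_line C (Y u $ 2)"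
  shows "solution I Y"
proof -
  have I: "open I" and smooth: "smooth_on I Y"
    using assms(1) by (auto simp: immersed_curve_def)
  have x: "Y u $ 1 = C" if "u \<in> I" for u
    using arg_cong[OF on[OF that], of "\<lambda>v. v $ 1"] by simp
  have x1: "vderiv 1 Y u $ 1 = 0" if "u \<in> I" for u
    by (rule deriv_eq_on_open[OF _ _ I that x])
       (use has_field_derivative_vderiv_component[OF smooth I that, of 0 1] in auto)
  have x2: "vderiv 2 Y u $ 1 = 0" if "u \<in> I" for u
    by (rule deriv_eq_on_open[OF _ _ I that x1])
       (use has_field_derivative_vderiv_component[OF smooth I that, of 1 1] in
         \<open>auto simp: numeral_2_eq_2\<close>)
  show ?thesis
    unfolding solution_iff_coordinates using assms(1) by (simp add: x1 x2 del: One_nat_def)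
qed

section \<open>The complete model curves\<close>

lemma has_vector_derivative_vector_2:
  fixes f g :: "real \<Rightarrow> real"
  assumes "(f has_field_derivative f') (at u)" "(g has_field_derivative g') (at u)"
  shows "((\<lambda>u. vector [f u, g u] :: real^2) has_vector_derivative vector [f', g']) (at u)"
proof -
  have vec: "(vector [a, b] :: real^2) = a *\<^sub>R axis 1 1 + b *\<^sub>R axis 2 1" for a b
    by (simp add: vec_eq_iff forall_2 axis_def)
  show ?thesis
    unfolding vec using assms
    by (auto intro!: derivative_eq_intros)
qed

lemma parabola_has_vector_derivative:
  "(parabola C1 C2 has_vector_derivative vector [1, x + C1]) (at x)"
  by (rule has_vector_derivative_vector_2) (auto intro!: derivative_eq_intros)

lemma vertical_line_has_vector_derivative:
  "(vertical_line C has_vector_derivative vector [0, 1]) (at y)"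
  by (rule has_vector_derivative_vector_2) (auto intro!: derivative_eq_intros)

lemma smooth_on_vertical_line: "smooth_on UNIV (vertical_line C)"
  by (rule smooth_on_antiderivative[OF vertical_line_has_vector_derivative smooth_on_const])

lemma smooth_on_parabola: "smooth_on UNIV (parabola C1 C2)"
proof (rule smooth_on_antiderivative[OF parabola_has_vector_derivative])
  have "((\<lambda>x. vector [1, x + C1] :: real^2) has_vector_derivative vector [0, 1]) (at x)" for x
    by (rule has_vector_derivative_vector_2) (auto intro!: derivative_eq_intros)
  then show "smooth_on UNIV (\<lambda>x. vector [1, x + C1] :: real^2)"
    by (rule smooth_on_antiderivative[OF _ smooth_on_const])
qed

lemma solution_parabola: "solution UNIV (parabola C1 C2)"
proof (rule solution_if_on_parabola)
  have "vderiv 1 (parabola C1 C2) x = vector [1, x + C1]" for x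
    using parabola_has_vector_derivative by (simp add: vderiv_Suc vector_derivative_at)
  then have "vderiv 1 (parabola C1 C2) x \<noteq> 0" for x
    by (simp add: vec_eq_iff forall_2)
  then show "immersed_curve UNIV (parabola C1 C2)"
    using smooth_on_parabola by (auto simp only: immersed_curve_def open_UNIV connected_UNIV)
qed simp

lemma solution_vertical_line: "solution UNIV (vertical_line C)"
proof (rule solution_if_on_vertical_line)
  have "vderiv 1 (vertical_line C) y = vector [0, 1]" for y
    using vertical_line_has_vector_derivative by (simp add: vderiv_Suc vector_derivative_at)
  then have "vderiv 1 (vertical_line C) y \<noteq> 0" for y
    by (simp add: vec_eq_iff forall_2)
  then show "immersed_curve UNIV (vertical_line C)"
    using smooth_on_vertical_line
    by (auto simp only: immersed_curve_def open_UNIV connected_UNIV)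
qed simp

section \<open>Coordinates as parameters, and maximality\<close>

text \<open>By the chain rule \<open>Y'\<close> is a multiple of the derivative of the coordinate, which therefore
  cannot vanish.\<close>

lemma coordinate_deriv_nonzero:
  assumes "immersed_curve I Y" "smooth_on UNIV P"
    and on: "\<And>u. u \<in> I \<Longrightarrow> Y u = P (Y u $ i)" and u: "u \<in> I"
  shows "vderiv 1 Y u $ i \<noteq> 0"
proof
  assume zero: "vderiv 1 Y u $ i = 0"
  have I: "open I" and smooth: "smooth_on I Y"
    using assms(1) by (auto simp: immersed_curve_def)
  have "((\<lambda>u. Y u $ i) has_vector_derivative 0) (at u)"
    using has_field_derivative_vderiv_component[OF smooth I u, of 0 i] zero
    by (simp add: has_real_derivative_iff_has_vector_derivative)
  moreover have "(P has_vector_derivative vderiv 1 P (Y u $ i)) (at (Y u $ i))"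
    using has_vector_derivative_vderiv[OF assms(2), of "Y u $ i" 0] by simp
  ultimately have "(P \<circ> (\<lambda>u. Y u $ i) has_vector_derivative 0) (at u)"
    using vector_diff_chain_at by fastforce
  then have "(Y has_vector_derivative 0) (at u)"
    by (rule has_vector_derivative_transform_within_open[OF _ I u]) (simp flip: on)
  then have "vderiv 1 Y u = 0"
    by (simp add: vderiv_Suc vector_derivative_at)
  then show False
    using assms(1) u by (simp add: immersed_curve_def)
qed

lemma coordinate_param_change:
  assumes "immersed_curve I Y" "smooth_on UNIV P" "\<And>u. u \<in> I \<Longrightarrow> Y u = P (Y u $ i)"
  shows "param_change I ((\<lambda>u. Y u $ i) ` I) (\<lambda>u. Y u $ i)"
proof -
  have I: "open I" "connected I" and smooth: "smooth_on I Y"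
    using assms(1) by (auto simp: immersed_curve_def)
  have nz: "vderiv 1 Y u $ i \<noteq> 0" if "u \<in> I" for u
    by (rule coordinate_deriv_nonzero[OF assms that])
  have "inj_on (\<lambda>u. Y u $ i) I"
    using has_field_derivative_vderiv_component[OF smooth I(1), of _ 0 i] nz
    by (intro inj_on_if_deriv_nonzero[OF I(2)]) auto
  then show ?thesis
    using nz vderiv_component[OF smooth I(1)] smooth_on_component[OF smooth I(1)]
    by (simp add: param_change_def inj_on_imp_bij_betw del: One_nat_def)
qed

lemma same_curve_if_maximal:
  assumes max: "maximal_solution I Y" and P: "solution UNIV P"
    and on: "\<And>u. u \<in> I \<Longrightarrow> Y u = P (Y u $ i)"
  shows "same_curve I Y UNIV P"
proof -
  have "immersed_curve I Y" "smooth_on UNIV P"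
    using max P by (auto simp: maximal_solution_def solution_def immersed_curve_def)
  from coordinate_param_change[OF this on]
  have change: "param_change I ((\<lambda>u. Y u $ i) ` I) (\<lambda>u. Y u $ i)" .
  then have "(\<lambda>u. Y u $ i) ` I = UNIV"
    using max P on unfolding maximal_solution_def by blast
  then show ?thesis
    using change on unfolding same_curve_def by (intro exI[of _ "\<lambda>u. Y u $ i"]) simp
qed

lemma on_curve_if_same_curve:
  assumes "same_curve I Y UNIV P" "\<And>t. P t $ i = t"
  shows "\<forall>u\<in>I. Y u = P (Y u $ i)" "Y ` I = range P"
proof -
  obtain \<phi> where \<phi>: "bij_betw \<phi> I UNIV" "\<And>u. u \<in> I \<Longrightarrow> Y u = P (\<phi> u)"
    using assms(1) by (auto simp: same_curve_def param_change_def)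
  show "\<forall>u\<in>I. Y u = P (Y u $ i)"
    using \<phi>(2) assms(2) by simp
  have "Y ` I = P ` \<phi> ` I"
    using \<phi>(2) by (auto simp: image_iff)
  then show "Y ` I = range P"
    using \<phi>(1) by (simp add: bij_betw_def)
qed

text \<open>The sub-arc \<open>Z \<circ> \<psi>\<close> already takes every value of the \<open>i\<close>-th coordinate, and along \<open>Z\<close> no
  value is taken twice.\<close>

lemma extension_trivial:
  assumes "immersed_curve J Z" "smooth_on UNIV Q" "\<And>v. v \<in> J \<Longrightarrow> Z v = Q (Z v $ i)"
    and sub: "\<psi> ` I \<subseteq> J" and YZ: "\<And>u. u \<in> I \<Longrightarrow> Y u = Z (\<psi> u)"
    and onto: "Y ` I = range P" and P: "\<And>t. P t $ i = t"
  shows "\<psi> ` I = J"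
proof
  show "J \<subseteq> \<psi> ` I"
  proof
    fix v assume v: "v \<in> J"
    have inj: "inj_on (\<lambda>v. Z v $ i) J"
      using coordinate_param_change[OF assms(1-3)] by (simp add: param_change_def bij_betw_def)
    have "P (Z v $ i) \<in> Y ` I"
      using onto by simp
    then obtain u where u: "u \<in> I" "Y u = P (Z v $ i)"
      by auto
    then have "Z (\<psi> u) $ i = Z v $ i"
      using YZ[OF u(1)] P by simp
    then have "\<psi> u = v"
      using inj v sub u(1) by (auto dest: inj_onD)
    then show "v \<in> \<psi> ` I"
      using u(1) by blast
  qed
qed (fact sub)

lemma maximal_if_same_curve_parabola:
  assumes imm: "immersed_curve I Y" and same: "same_curve I Y UNIV (parabola C1 C2)"
  shows "maximal_solution I Y"
proof -
  note Y = on_curve_if_same_curve[OF same vector_2(1)]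
  have "\<psi> ` I = J" if Z: "solution J Z" and sub: "\<psi> ` I \<subseteq> J" and YZ: "\<forall>u\<in>I. Y u = Z (\<psi> u)"
    for J Z \<psi>
  proof -
    have immZ: "immersed_curve J Z"
      using Z by (simp add: solution_def)
    consider D1 D2 where "\<forall>v\<in>J. Z v = parabola D1 D2 (Z v $ 1)"
      | D where "\<forall>v\<in>J. Z v = vertical_line D (Z v $ 2)"
      using solution_on_parabola_or_line[OF Z] by blast
    then show ?thesis
    proof cases
      case 1
      show ?thesis
        by (rule extension_trivial[OF immZ smooth_on_parabola 1[rule_format] sub
              YZ[rule_format] Y(2) vector_2(1)])
    next
      case 2
      \<comment> \<open>A vertical line misses all but one abscissa of the parabola.\<close>
      have "parabola C1 C2 (D + 1) \<in> Y ` I"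
        using Y(2) by blast
      then obtain u where u: "u \<in> I" "Y u = parabola C1 C2 (D + 1)"
        by auto
      have "Z (\<psi> u) = vertical_line D (Z (\<psi> u) $ 2)"
        using 2 sub u(1) by blast
      then have "Z (\<psi> u) $ 1 = D"
        by (metis vector_2(1))
      moreover have "Z (\<psi> u) = parabola C1 C2 (D + 1)"
        using YZ u by simp
      ultimately show ?thesis
        by simp
    qed
  qed
  moreover have "solution I Y"
    using solution_if_on_parabola[OF imm] Y(1) by blast
  ultimately show ?thesis
    unfolding maximal_solution_def by blast
qed

lemma maximal_if_same_curve_vertical_line:
  assumes imm: "immersed_curve I Y" and same: "same_curve I Y UNIV (vertical_line C)"
  shows "maximal_solution I Y"
proof -
  note Y = on_curve_if_same_curve[OF same vector_2(2)]
  have "\<psi> ` I = J" if Z: "solution J Z" and sub: "\<psi> ` I \<subseteq> J" and YZ: "\<forall>u\<in>I. Y u = Z (\<psi> u)"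
    for J Z \<psi>
  proof -
    have immZ: "immersed_curve J Z"
      using Z by (simp add: solution_def)
    consider D1 D2 where "\<forall>v\<in>J. Z v = parabola D1 D2 (Z v $ 1)"
      | D where "\<forall>v\<in>J. Z v = vertical_line D (Z v $ 2)"
      using solution_on_parabola_or_line[OF Z] by blast
    then show ?thesis
    proof cases
      case 1
      \<comment> \<open>A parabola of the family meets the line in a single point.\<close>
      define y where "y = 1/2 * C^2 + D1 * C + D2 + 1"
      have "vertical_line C y \<in> Y ` I"
        using Y(2) by blast
      then obtain u where u: "u \<in> I" "Y u = vertical_line C y"
        by auto
      have "Z (\<psi> u) = parabola D1 D2 (Z (\<psi> u) $ 1)"
        using 1 sub u(1) by blast
      then have "Z (\<psi> u) $ 2 = 1/2 * (Z (\<psi> u) $ 1)^2 + D1 * Z (\<psi> u) $ 1 + D2"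
        by (metis vector_2(2))
      moreover have "Z (\<psi> u) = vertical_line C y"
        using YZ u by simp
      ultimately show ?thesis
        by (simp add: y_def)
    next
      case 2
      show ?thesis
        by (rule extension_trivial[OF immZ smooth_on_vertical_line 2[rule_format] sub
              YZ[rule_format] Y(2) vector_2(2)])
    qed
  qed
  moreover have "solution I Y"
    using solution_if_on_vertical_line[OF imm] Y(1) by blast
  ultimately show ?thesis
    unfolding maximal_solution_def by blast
qed

theorem theorem3p1:
  fixes I :: "real set" and Y :: "real \<Rightarrow> real^2"
  assumes "immersed_curve I Y"
  shows "maximal_solution I Y \<longleftrightarrow>
    (\<exists>C1 C2 :: real. same_curve I Y UNIV (\<lambda>x. vector [x, 1/2 * x^2 + C1 * x + C2])) \<or>
    (\<exists>C :: real. same_curve I Y UNIV (\<lambda>y. vector [C, y]))"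
proof
  assume max: "maximal_solution I Y"
  then have "solution I Y"
    by (simp add: maximal_solution_def)
  then consider C1 C2 where "\<forall>u\<in>I. Y u = parabola C1 C2 (Y u $ 1)"
    | C where "\<forall>u\<in>I. Y u = vertical_line C (Y u $ 2)"
    using solution_on_parabola_or_line by blast
  then show "(\<exists>C1 C2. same_curve I Y UNIV (parabola C1 C2)) \<or>
      (\<exists>C. same_curve I Y UNIV (vertical_line C))"
  proof cases
    case 1
    then show ?thesis
      using same_curve_if_maximal[OF max solution_parabola, where i = 1] by blast
  next
    case 2
    then show ?thesis
      using same_curve_if_maximal[OF max solution_vertical_line, where i = 2] by blast
  qed
next
  assume "(\<exists>C1 C2. same_curve I Y UNIV (parabola C1 C2)) \<or>
      (\<exists>C. same_curve I Y UNIV (vertical_line C))"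
  then show "maximal_solution I Y"
    using maximal_if_same_curve_parabola[OF assms] maximal_if_same_curve_vertical_line[OF assms]
    by blast
qed

end
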